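(* Let $\mathcal N$ be a regular map in class I such that $\mathrm{Aut}\,\mathcal N$ is almost simple. Then the map $\mathcal M=\mathcal N_{\Sigma^+}$ is in class III. (Equivalently: if $N$ is the map subgroup of $\mathcal N$, so that $N$ is a normal subgroup of $\Gamma$ with six distinct images under $\Sigma$ and $\Gamma/N$ is almost simple, then $N_{\Sigma^+}=\bigcap_{\sigma\in\Sigma^+}\sigma(N)$ is invariant under $\Sigma^+$ but not under $\Sigma$.)
   Context: Let $\Gamma=\langle R_0,R_1,R_2\mid R_0^2=R_1^2=R_2^2=(R_0R_2)^2=1\rangle$, the free product of the Klein four-group $V=\langle R_0,R_2\rangle$ and $C=\langle R_1\rangle\cong C_2$. Regular maps $\mathcal M$ on surfaces, up to isomorphism, are identified with normal subgroups $M$ of $\Gamma$ (the map subgroups), with $\mathrm{Aut}\,\mathcal M\cong\Gamma/M$; maps are without boundary and without free edges, i.e. $M$ contains no conjugate of $R_0$, $R_1$, $R_2$ or $R_0R_2$. Let $\Sigma\cong S_3$ be the group of the six automorphisms of $\Gamma$ that fix $R_1$ and permute the three involutions $R_0,R_2,R_0R_2$ of $V$. It acts on the normal subgroups of $\Gamma$, hence on regular maps; this is Wilson's group of map operations. Let $\Sigma^+\cong C_3$ be its subgroup of order $3$. A regular map with map subgroup $M$ is in class I if $M$ has six distinct images under $\Sigma$, and in class III if its $\Sigma$-orbit has exactly two elements, i.e. $M$ is invariant under $\Sigma^+$ but not under $\Sigma$. For a regular map $\mathcal N$ with map subgroup $N$, $\mathcal N_{\Sigma^+}$ denotes the regular map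 with map subgroup $N_{\Sigma^+}=\bigcap_{\sigma\in\Sigma^+}\sigma(N)$. A group $A$ is almost simple if it has a non-abelian simple normal subgroup $S$ such that $C_A(S)=1$. *)

theory Defs
  imports "HOL-Algebra.Algebra"
begin

section \<open>Groups given by presentations\<close>

text \<open>A letter \<open>(g, False)\<close> stands for the generator \<open>g\<close>, and \<open>(g, True)\<close> for its formal inverse.\<close>

type_synonym 'g word = "('g \<times> bool) list"

inductive word_eq :: "'g word set \<Rightarrow> 'g word \<Rightarrow> 'g word \<Rightarrow> bool" for rels where
  refl: "word_eq rels u u"
| sym: "word_eq rels u v \<Longrightarrow> word_eq rels v u"
| trans: "word_eq rels u v \<Longrightarrow> word_eq rels v w \<Longrightarrow> word_eq rels u w"
| append: "word_eq rels u u' \<Longrightarrow> word_eq rels v v' \<Longrightarrow> word_eq rels (u @ v) (u' @ v')"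
| cancel: "word_eq rels [(g, b), (g, \<not> b)] []"
| relator: "r \<in> rels \<Longrightarrow> word_eq rels r []"

definition word_class :: "'g word set \<Rightarrow> 'g word \<Rightarrow> 'g word set" where
  "word_class rels u = {v. word_eq rels u v}"

definition presented_group :: "'g word set \<Rightarrow> 'g word set monoid" where
  "presented_group rels =
     \<lparr>carrier = range (word_class rels),
      monoid.mult = (\<lambda>A B. {w. \<exists>u\<in>A. \<exists>v\<in>B. word_eq rels (u @ v) w}),
      one = word_class rels []\<rparr>"


section \<open>The group \<open>\<Gamma>\<close> and Wilson's operations\<close>

datatype generator = r0 | r1 | r2

definition Gamma_relators :: "generator word set" where
  "Gamma_relators =
     {[(r0, False), (r0, False)],
      [(r1, False), (r1, False)],
      [(r2, False), (r2, False)],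
      [(r0, False), (r2, False), (r0, False), (r2, False)]}"

definition Gamma :: "generator word set monoid" where
  "Gamma = presented_group Gamma_relators"

definition R0 :: "generator word set" where "R0 = word_class Gamma_relators [(r0, False)]"
definition R1 :: "generator word set" where "R1 = word_class Gamma_relators [(r1, False)]"
definition R2 :: "generator word set" where "R2 = word_class Gamma_relators [(r2, False)]"

definition V_involutions :: "generator word set set" where
  "V_involutions = {R0, R2, R0 \<otimes>\<^bsub>Gamma\<^esub> R2}"

definition Sigma_group :: "(generator word set \<Rightarrow> generator word set) monoid" where
  "Sigma_group = (AutoGroup Gamma)
     \<lparr>carrier := {\<sigma> \<in> auto Gamma. \<sigma> R1 = R1 \<and> \<sigma> ` V_involutions = V_involutions}\<rparr>"

text \<open>That the subgroup of order 3 exists and is unique is shown below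
  (lemma \<open>ex1_subgroup_order_3\<close>).\<close>

definition Sigma_plus :: "(generator word set \<Rightarrow> generator word set) set" where
  "Sigma_plus = (THE H. subgroup H Sigma_group \<and> card H = 3)"


section \<open>Regular maps\<close>

text \<open>Regular maps are represented by their map subgroups; the condition on conjugates
  excludes maps with boundary or with free edges.\<close>

definition regular_map :: "generator word set set \<Rightarrow> bool" where
  "regular_map M \<longleftrightarrow> M \<lhd> Gamma \<and>
     (\<forall>x \<in> {R0, R1, R2, R0 \<otimes>\<^bsub>Gamma\<^esub> R2}. \<forall>g \<in> carrier Gamma.
        g \<otimes>\<^bsub>Gamma\<^esub> x \<otimes>\<^bsub>Gamma\<^esub> inv\<^bsub>Gamma\<^esub> g \<notin> M)"

definition Aut_map :: "generator word set set \<Rightarrow> generator word set set monoid" where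
  "Aut_map M = Gamma Mod M"

definition Sigma_orbit :: "generator word set set \<Rightarrow> generator word set set set" where
  "Sigma_orbit M = (\<lambda>\<sigma>. \<sigma> ` M) ` carrier Sigma_group"

definition class_I :: "generator word set set \<Rightarrow> bool" where
  "class_I M \<longleftrightarrow> regular_map M \<and> card (Sigma_orbit M) = 6"

definition class_III :: "generator word set set \<Rightarrow> bool" where
  "class_III M \<longleftrightarrow> regular_map M \<and> card (Sigma_orbit M) = 2"

definition Sigma_plus_core :: "generator word set set \<Rightarrow> generator word set set" where
  "Sigma_plus_core N = (\<Inter>\<sigma> \<in> Sigma_plus. \<sigma> ` N)"


section \<open>Almost simple groups\<close>

text \<open>The library's \<open>simple_group\<close> requires \<open>order G > 1\<close>, where \<open>order\<close> is a \<open>card\<close>,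
  and so excludes infinite simple groups.\<close>

definition is_simple :: "('a, 'b) monoid_scheme \<Rightarrow> bool" where
  "is_simple G \<longleftrightarrow> group G \<and> carrier G \<noteq> {\<one>\<^bsub>G\<^esub>} \<and>
     (\<forall>H. H \<lhd> G \<longrightarrow> H = carrier G \<or> H = {\<one>\<^bsub>G\<^esub>})"

definition centralizer :: "('a, 'b) monoid_scheme \<Rightarrow> 'a set \<Rightarrow> 'a set" where
  "centralizer G S = {x \<in> carrier G. \<forall>s \<in> S. x \<otimes>\<^bsub>G\<^esub> s = s \<otimes>\<^bsub>G\<^esub> x}"

definition almost_simple :: "('a, 'b) monoid_scheme \<Rightarrow> bool" where
  "almost_simple G \<longleftrightarrow> group G \<and>
     (\<exists>S. S \<lhd> G \<and> is_simple (G\<lparr>carrier := S\<rparr>) \<and> \<not> comm_group (G\<lparr>carrier := S\<rparr>) \<and>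
          centralizer G S = {\<one>\<^bsub>G\<^esub>})"


section \<open>Basic facts\<close>

subsection \<open>Presented groups\<close>

lemma word_class_eq_iff: "word_class rels u = word_class rels v \<longleftrightarrow> word_eq rels u v"
  unfolding word_class_def by (blast intro: word_eq.intros)

lemma mult_word_class:
  "word_class rels u \<otimes>\<^bsub>presented_group rels\<^esub> word_class rels v = word_class rels (u @ v)"
proof -
  have "(\<exists>u'\<in>word_class rels u. \<exists>v'\<in>word_class rels v. word_eq rels (u' @ v') w)
          \<longleftrightarrow> word_eq rels (u @ v) w" for w
    unfolding word_class_def by (blast intro: word_eq.intros)
  then show ?thesis
    by (simp add: presented_group_def word_class_def)
qed

lemma word_eq_inverse: "word_eq rels (rev (map (\<lambda>(g, b). (g, \<not> b)) u) @ u) []"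
proof (induction u)
  case Nil
  show ?case by (simp add: word_eq.refl)
next
  case (Cons a u)
  obtain g b where a: "a = (g, b)" by (cases a)
  let ?u = "rev (map (\<lambda>(g, b). (g, \<not> b)) u)"
  have "word_eq rels [(g, \<not> b), (g, b)] []"
    using word_eq.cancel[of rels g "\<not> b"] by simp
  then have "word_eq rels ((?u @ [(g, \<not> b), (g, b)]) @ u) ((?u @ []) @ u)"
    by (intro word_eq.append word_eq.refl)
  then show ?case using Cons a by (auto intro: word_eq.trans)
qed

lemma group_presented_group: "group (presented_group rels)"
proof (rule groupI)
  fix x assume "x \<in> carrier (presented_group rels)"
  then obtain u where u: "x = word_class rels u" by (auto simp: presented_group_def)
  let ?y = "word_class rels (rev (map (\<lambda>(g, b). (g, \<not> b)) u))"
  have "?y \<otimes>\<^bsub>presented_group rels\<^esub> x = \<one>\<^bsub>presented_group rels\<^esub>"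
    unfolding u mult_word_class
    by (simp add: presented_group_def word_class_eq_iff word_eq_inverse)
  moreover have "?y \<in> carrier (presented_group rels)" by (simp add: presented_group_def)
  ultimately show "\<exists>y\<in>carrier (presented_group rels). y \<otimes>\<^bsub>presented_group rels\<^esub> x = \<one>\<^bsub>presented_group rels\<^esub>"
    by blast
next
  show "x \<otimes>\<^bsub>presented_group rels\<^esub> y \<in> carrier (presented_group rels)"
    if "x \<in> carrier (presented_group rels)" "y \<in> carrier (presented_group rels)" for x y
  proof -
    obtain u v where "x = word_class rels u" "y = word_class rels v"
      using \<open>x \<in> _\<close> \<open>y \<in> _\<close> by (auto simp: presented_group_def)
    then have "x \<otimes>\<^bsub>presented_group rels\<^esub> y = word_class rels (u @ v)"
      by (simp only: mult_word_class)
    then show ?thesis by (simp add: presented_group_def)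
  qed
next
  show "\<one>\<^bsub>presented_group rels\<^esub> \<in> carrier (presented_group rels)"
    by (simp add: presented_group_def)
next
  fix x y z
  assume "x \<in> carrier (presented_group rels)" "y \<in> carrier (presented_group rels)"
    "z \<in> carrier (presented_group rels)"
  then obtain u v w where "x = word_class rels u" "y = word_class rels v" "z = word_class rels w"
    by (auto simp: presented_group_def)
  then show "x \<otimes>\<^bsub>presented_group rels\<^esub> y \<otimes>\<^bsub>presented_group rels\<^esub> z
           = x \<otimes>\<^bsub>presented_group rels\<^esub> (y \<otimes>\<^bsub>presented_group rels\<^esub> z)"
    by (simp only: mult_word_class append_assoc)
next
  fix x assume "x \<in> carrier (presented_group rels)"
  then obtain u where u: "x = word_class rels u" by (auto simp: presented_group_def)
  have "\<one>\<^bsub>presented_group rels\<^esub> = word_class rels []" by (simp add: presented_group_def)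
  then show "\<one>\<^bsub>presented_group rels\<^esub> \<otimes>\<^bsub>presented_group rels\<^esub> x = x"
    by (simp only: u mult_word_class append_Nil)
qed

fun word_val :: "('a, 'b) monoid_scheme \<Rightarrow> ('g \<Rightarrow> 'a) \<Rightarrow> 'g word \<Rightarrow> 'a" where
  "word_val G f [] = \<one>\<^bsub>G\<^esub>"
| "word_val G f ((g, b) # u) = (if b then inv\<^bsub>G\<^esub> f g else f g) \<otimes>\<^bsub>G\<^esub> word_val G f u"

lemma (in group) word_val_closed:
  assumes "range f \<subseteq> carrier G"
  shows "word_val G f u \<in> carrier G"
proof -
  have "f g \<in> carrier G" for g using assms by auto
  then show ?thesis by (induction u) auto
qed

lemma (in group) word_val_append:
  assumes "range f \<subseteq> carrier G"
  shows "word_val G f (u @ v) = word_val G f u \<otimes> word_val G f v"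
proof -
  have f: "f g \<in> carrier G" for g using assms by auto
  show ?thesis
    by (induction u) (auto simp: f m_assoc word_val_closed[OF assms])
qed

lemma (in group) word_val_cong:
  assumes "range f \<subseteq> carrier G" "\<And>r. r \<in> rels \<Longrightarrow> word_val G f r = \<one>" "word_eq rels u v"
  shows "word_val G f u = word_val G f v"
proof -
  have f: "f g \<in> carrier G" for g using assms(1) by auto
  show ?thesis
    using assms(3)
    by induction (auto simp: f word_val_append[OF assms(1)] assms(2))
qed

lemma (in group) presented_group_hom:
  assumes f: "range f \<subseteq> carrier G" and rels: "\<And>r. r \<in> rels \<Longrightarrow> word_val G f r = \<one>"
  shows "\<exists>h \<in> hom (presented_group rels) G. \<forall>u. h (word_class rels u) = word_val G f u"
proof -
  define h where "h A = word_val G f (SOME u. u \<in> A)" for A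
  have h: "h (word_class rels u) = word_val G f u" for u
  proof -
    have "(SOME v. v \<in> word_class rels u) \<in> word_class rels u"
      by (rule someI[of _ u]) (simp add: word_class_def word_eq.refl)
    then have "word_eq rels u (SOME v. v \<in> word_class rels u)"
      by (simp add: word_class_def)
    from word_val_cong[OF f rels this] show ?thesis by (simp add: h_def)
  qed
  have "h \<in> hom (presented_group rels) G"
  proof (rule homI)
    fix x assume "x \<in> carrier (presented_group rels)"
    then show "h x \<in> carrier G"
      by (auto simp: presented_group_def h word_val_closed[OF f])
  next
    fix x y assume "x \<in> carrier (presented_group rels)" "y \<in> carrier (presented_group rels)"
    then obtain u v where "x = word_class rels u" "y = word_class rels v"
      by (auto simp: presented_group_def)
    then show "h (x \<otimes>\<^bsub>presented_group rels\<^esub> y) = h x \<otimes> h y"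
      by (simp only: mult_word_class h word_val_append[OF f])
  qed
  with h show ?thesis by blast
qed

lemma presented_group_hom_eq_word_val:
  assumes "group G" and h: "h \<in> hom (presented_group rels) G"
  shows "h (word_class rels u) = word_val G (\<lambda>g. h (word_class rels [(g, False)])) u"
proof -
  interpret G: group G by fact
  interpret P: group "presented_group rels" by (rule group_presented_group)
  interpret group_hom "presented_group rels" G h
    by (simp add: group_hom_def group_hom_axioms_def h G.group_axioms P.group_axioms)
  have cl: "word_class rels v \<in> carrier (presented_group rels)" for v
    by (simp add: presented_group_def)
  have one: "word_class rels [] = \<one>\<^bsub>presented_group rels\<^esub>" by (simp add: presented_group_def)
  have inv: "word_class rels [(g, True)] = inv\<^bsub>presented_group rels\<^esub> word_class rels [(g, False)]" for g
  proof -
    have "word_class rels [(g, True)] \<otimes>\<^bsub>presented_group rels\<^esub> word_class rels [(g, False)]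
            = \<one>\<^bsub>presented_group rels\<^esub>"
      using word_eq.cancel[of rels g True] by (simp add: mult_word_class one[symmetric] word_class_eq_iff)
    then show ?thesis using P.inv_equality[OF _ cl cl] by metis
  qed
  show ?thesis
  proof (induction u)
    case Nil
    then show ?case by (simp add: one)
  next
    case (Cons a u)
    obtain g b where a: "a = (g, b)" by (cases a)
    have "word_class rels (a # u)
            = word_class rels [a] \<otimes>\<^bsub>presented_group rels\<^esub> word_class rels u"
      by (simp add: mult_word_class)
    then show ?case using Cons a inv cl by (cases b) simp_all
  qed
qed


subsection \<open>The group \<open>\<Gamma>\<close>\<close>

interpretation Gamma: group Gamma
  unfolding Gamma_def by (rule group_presented_group)

lemma R_closed [simp]:
  "R0 \<in> carrier Gamma" "R1 \<in> carrier Gamma" "R2 \<in> carrier Gamma"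
  by (auto simp: R0_def R1_def R2_def Gamma_def presented_group_def)

lemma R_relations:
  "R0 \<otimes>\<^bsub>Gamma\<^esub> R0 = \<one>\<^bsub>Gamma\<^esub>" "R1 \<otimes>\<^bsub>Gamma\<^esub> R1 = \<one>\<^bsub>Gamma\<^esub>" "R2 \<otimes>\<^bsub>Gamma\<^esub> R2 = \<one>\<^bsub>Gamma\<^esub>"
  "(R0 \<otimes>\<^bsub>Gamma\<^esub> R2) \<otimes>\<^bsub>Gamma\<^esub> (R0 \<otimes>\<^bsub>Gamma\<^esub> R2) = \<one>\<^bsub>Gamma\<^esub>"
proof -
  have one: "\<one>\<^bsub>Gamma\<^esub> = word_class Gamma_relators []" by (simp add: Gamma_def presented_group_def)
  note defs = R0_def R1_def R2_def Gamma_def[THEN arg_cong[of _ _ monoid.mult]] mult_word_class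
  show "R0 \<otimes>\<^bsub>Gamma\<^esub> R0 = \<one>\<^bsub>Gamma\<^esub>" "R1 \<otimes>\<^bsub>Gamma\<^esub> R1 = \<one>\<^bsub>Gamma\<^esub>"
    "R2 \<otimes>\<^bsub>Gamma\<^esub> R2 = \<one>\<^bsub>Gamma\<^esub>"
    "(R0 \<otimes>\<^bsub>Gamma\<^esub> R2) \<otimes>\<^bsub>Gamma\<^esub> (R0 \<otimes>\<^bsub>Gamma\<^esub> R2) = \<one>\<^bsub>Gamma\<^esub>"
    unfolding one defs word_class_eq_iff
    by (rule word_eq.relator, simp add: Gamma_relators_def)+
qed

lemma Gamma_hom:
  assumes "group G" "a \<in> carrier G" "b \<in> carrier G" "c \<in> carrier G"
    and "a \<otimes>\<^bsub>G\<^esub> a = \<one>\<^bsub>G\<^esub>" "b \<otimes>\<^bsub>G\<^esub> b = \<one>\<^bsub>G\<^esub>" "c \<otimes>\<^bsub>G\<^esub> c = \<one>\<^bsub>G\<^esub>"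
    and "(a \<otimes>\<^bsub>G\<^esub> c) \<otimes>\<^bsub>G\<^esub> (a \<otimes>\<^bsub>G\<^esub> c) = \<one>\<^bsub>G\<^esub>"
  shows "\<exists>h \<in> hom Gamma G. h R0 = a \<and> h R1 = b \<and> h R2 = c"
proof -
  interpret G: group G by fact
  define f where "f = case_generator a b c"
  have [simp]: "f r0 = a" "f r1 = b" "f r2 = c" by (simp_all add: f_def)
  have "range f \<subseteq> carrier G" using assms by (auto simp: f_def split: generator.splits)
  moreover have "word_val G f r = \<one>\<^bsub>G\<^esub>" if "r \<in> Gamma_relators" for r
    using that assms by (auto simp: Gamma_relators_def G.m_assoc)
  ultimately obtain h where h: "h \<in> hom Gamma G" "\<forall>u. h (word_class Gamma_relators u) = word_val G f u"
    using G.presented_group_hom[of f Gamma_relators] by (auto simp: Gamma_def)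
  then show ?thesis using assms by (auto intro!: bexI[of _ h] simp: R0_def R1_def R2_def)
qed

lemma Gamma_hom_ext:
  assumes "group G" "h \<in> hom Gamma G" "k \<in> hom Gamma G"
    and "h R0 = k R0" "h R1 = k R1" "h R2 = k R2" and "x \<in> carrier Gamma"
  shows "h x = k x"
proof -
  obtain u where u: "x = word_class Gamma_relators u"
    using assms(7) by (auto simp: Gamma_def presented_group_def)
  have "h (word_class Gamma_relators [(g, False)]) = k (word_class Gamma_relators [(g, False)])" for g
    using assms(4-6) by (cases g) (auto simp: R0_def R1_def R2_def)
  then show ?thesis
    unfolding u using presented_group_hom_eq_word_val[OF assms(1)] assms(2,3)
    by (metis (no_types, lifting) Gamma_def ext)
qed

lemma V_distinct:
  "R0 \<noteq> R2" "R0 \<noteq> R0 \<otimes>\<^bsub>Gamma\<^esub> R2" "R2 \<noteq> R0 \<otimes>\<^bsub>Gamma\<^esub> R2"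
proof -
  define B where "B = \<lparr>carrier = (UNIV :: bool set), monoid.mult = (\<noteq>), one = False\<rparr>"
  interpret B: group B by (rule groupI) (auto simp: B_def)
  obtain h where h: "h \<in> hom Gamma B" "h R0" "\<not> h R2"
    using Gamma_hom[of B True False False] B.group_axioms by (auto simp: B_def)
  obtain k where k: "k \<in> hom Gamma B" "\<not> k R0" "k R2"
    using Gamma_hom[of B False False True] B.group_axioms by (auto simp: B_def)
  have "h (R0 \<otimes>\<^bsub>Gamma\<^esub> R2)" "k (R0 \<otimes>\<^bsub>Gamma\<^esub> R2)"
    using hom_mult[OF h(1), of R0 R2] hom_mult[OF k(1), of R0 R2] h k by (auto simp: B_def)
  then show "R0 \<noteq> R2" "R0 \<noteq> R0 \<otimes>\<^bsub>Gamma\<^esub> R2" "R2 \<noteq> R0 \<otimes>\<^bsub>Gamma\<^esub> R2"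
    using h k by metis+
qed

lemma V_mult:
  "R2 \<otimes>\<^bsub>Gamma\<^esub> R0 = R0 \<otimes>\<^bsub>Gamma\<^esub> R2"
  "R0 \<otimes>\<^bsub>Gamma\<^esub> (R0 \<otimes>\<^bsub>Gamma\<^esub> R2) = R2" "R0 \<otimes>\<^bsub>Gamma\<^esub> R2 \<otimes>\<^bsub>Gamma\<^esub> R0 = R2"
  "R2 \<otimes>\<^bsub>Gamma\<^esub> (R0 \<otimes>\<^bsub>Gamma\<^esub> R2) = R0" "R0 \<otimes>\<^bsub>Gamma\<^esub> R2 \<otimes>\<^bsub>Gamma\<^esub> R2 = R0"
proof -
  have inv: "inv\<^bsub>Gamma\<^esub> R0 = R0" "inv\<^bsub>Gamma\<^esub> R2 = R2"
    "inv\<^bsub>Gamma\<^esub> (R0 \<otimes>\<^bsub>Gamma\<^esub> R2) = R0 \<otimes>\<^bsub>Gamma\<^esub> R2"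
    by (simp_all add: Gamma.inv_equality R_relations)
  then show comm: "R2 \<otimes>\<^bsub>Gamma\<^esub> R0 = R0 \<otimes>\<^bsub>Gamma\<^esub> R2"
    by (metis Gamma.inv_mult_group R_closed(1,3))
  show 1: "R0 \<otimes>\<^bsub>Gamma\<^esub> (R0 \<otimes>\<^bsub>Gamma\<^esub> R2) = R2"
    by (simp add: Gamma.m_assoc[symmetric] R_relations)
  show 2: "R0 \<otimes>\<^bsub>Gamma\<^esub> R2 \<otimes>\<^bsub>Gamma\<^esub> R2 = R0"
    by (simp add: Gamma.m_assoc R_relations)
  show "R0 \<otimes>\<^bsub>Gamma\<^esub> R2 \<otimes>\<^bsub>Gamma\<^esub> R0 = R2"
    using 1 comm by (simp add: Gamma.m_assoc)
  show "R2 \<otimes>\<^bsub>Gamma\<^esub> (R0 \<otimes>\<^bsub>Gamma\<^esub> R2) = R0"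
    using 2 comm by (simp add: Gamma.m_assoc[symmetric])
qed


subsection \<open>The group \<open>\<Sigma>\<close>\<close>

lemma group_Sigma_group: "group Sigma_group"
proof -
  let ?S = "{\<sigma> \<in> auto Gamma. \<sigma> R1 = R1 \<and> \<sigma> ` V_involutions = V_involutions}"
  interpret A: group "AutoGroup Gamma" by (rule Gamma.AutoGroup)
  have V: "V_involutions \<subseteq> carrier Gamma" by (auto simp: V_involutions_def)
  have mult: "\<sigma> \<otimes>\<^bsub>AutoGroup Gamma\<^esub> \<tau> = compose (carrier Gamma) \<sigma> \<tau>"
    if "\<sigma> \<in> auto Gamma" "\<tau> \<in> auto Gamma" for \<sigma> \<tau>
    using that by (simp add: AutoGroup_def BijGroup_def auto_def)
  have one: "\<one>\<^bsub>AutoGroup Gamma\<^esub> = (\<lambda>x\<in>carrier Gamma. x)"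
    by (simp add: AutoGroup_def BijGroup_def)
  have carr: "carrier (AutoGroup Gamma) = auto Gamma" by (simp add: AutoGroup_def)
  have "subgroup ?S (AutoGroup Gamma)"
  proof (rule A.subgroupI)
    show "?S \<subseteq> carrier (AutoGroup Gamma)" by (auto simp: carr)
    have "\<one>\<^bsub>AutoGroup Gamma\<^esub> \<in> ?S"
      using V Gamma.id_in_auto by (auto simp: one image_restrict_eq cong: image_cong_simp)
    then show "?S \<noteq> {}" by blast
  next
    fix \<sigma> assume s: "\<sigma> \<in> ?S"
    let ?t = "inv\<^bsub>AutoGroup Gamma\<^esub> \<sigma>"
    have t: "?t \<in> auto Gamma" using s A.inv_closed by (simp add: carr)
    have comp: "compose (carrier Gamma) ?t \<sigma> = (\<lambda>x\<in>carrier Gamma. x)"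
      using A.l_inv[of \<sigma>] s t by (simp add: mult one carr)
    have ts: "?t (\<sigma> x) = x" if "x \<in> carrier Gamma" for x
      using fun_cong[OF comp, of x] that by (simp add: compose_eq)
    have "?t R1 = R1" using ts[of R1] s by simp
    moreover have "?t ` V_involutions = V_involutions"
    proof -
      have "?t ` V_involutions = ?t ` \<sigma> ` V_involutions" using s by simp
      also have "\<dots> = V_involutions" using ts V by (simp add: image_image subset_iff)
      finally show ?thesis .
    qed
    ultimately show "?t \<in> ?S" using t by simp
  next
    fix \<sigma> \<tau> assume s: "\<sigma> \<in> ?S" "\<tau> \<in> ?S"
    have "\<sigma> \<otimes>\<^bsub>AutoGroup Gamma\<^esub> \<tau> \<in> auto Gamma" using s A.m_closed by (simp add: carr)
    moreover have "compose (carrier Gamma) \<sigma> \<tau> ` V_involutions = \<sigma> ` \<tau> ` V_involutions"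
      unfolding image_image using V by (intro image_cong) (auto simp: compose_eq)
    ultimately show "\<sigma> \<otimes>\<^bsub>AutoGroup Gamma\<^esub> \<tau> \<in> ?S"
      using s by (auto simp: mult compose_eq)
  qed
  then show ?thesis
    unfolding Sigma_group_def by (rule A.subgroup_imp_group)
qed

lemma Sigma_one: "\<one>\<^bsub>Sigma_group\<^esub> = (\<lambda>x\<in>carrier Gamma. x)"
  by (simp add: Sigma_group_def AutoGroup_def BijGroup_def)

lemma Sigma_mult:
  assumes "\<sigma> \<in> carrier Sigma_group" "\<tau> \<in> carrier Sigma_group"
  shows "\<sigma> \<otimes>\<^bsub>Sigma_group\<^esub> \<tau> = compose (carrier Gamma) \<sigma> \<tau>"
  using assms by (simp add: Sigma_group_def AutoGroup_def BijGroup_def auto_def)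

lemma Sigma_hom: "\<sigma> \<in> carrier Sigma_group \<Longrightarrow> \<sigma> \<in> hom Gamma Gamma"
  by (simp add: Sigma_group_def auto_def)

definition V_images :: "(generator word set \<Rightarrow> generator word set) \<Rightarrow> generator word set \<times> generator word set" where
  "V_images \<sigma> = (\<sigma> R0, \<sigma> R2)"

lemma inj_V_images: "inj_on V_images (carrier Sigma_group)"
proof (rule inj_onI)
  fix \<sigma> \<tau> assume s: "\<sigma> \<in> carrier Sigma_group" "\<tau> \<in> carrier Sigma_group" and "V_images \<sigma> = V_images \<tau>"
  then have "\<sigma> R0 = \<tau> R0" "\<sigma> R1 = \<tau> R1" "\<sigma> R2 = \<tau> R2"
    by (auto simp: V_images_def Sigma_group_def)
  then have "\<sigma> x = \<tau> x" if "x \<in> carrier Gamma" for x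
    using Gamma_hom_ext[OF Gamma.group_axioms] s that Sigma_hom by blast
  moreover have "\<sigma> \<in> extensional (carrier Gamma)" "\<tau> \<in> extensional (carrier Gamma)"
    using s by (auto simp: Sigma_group_def auto_def Bij_def)
  ultimately show "\<sigma> = \<tau>" by (rule extensionalityI[rotated 2])
qed

lemma Sigma_existence:
  assumes xy: "x \<in> V_involutions" "y \<in> V_involutions" "x \<noteq> y"
  shows "\<exists>\<sigma> \<in> carrier Sigma_group. V_images \<sigma> = (x, y)"
proof -
  let ?P = "R0 \<otimes>\<^bsub>Gamma\<^esub> R2"
  have hom: "\<exists>h \<in> hom Gamma Gamma. h R0 = a \<and> h R1 = R1 \<and> h R2 = b"
    if "a \<in> V_involutions" "b \<in> V_involutions" "a \<noteq> b" for a b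
    using that
    by (intro Gamma_hom[OF Gamma.group_axioms]) (auto simp: V_involutions_def R_relations V_mult)
  from hom[OF xy] obtain h where h: "h \<in> hom Gamma Gamma" "h R0 = x" "h R1 = R1" "h R2 = y" by blast
  have hP: "h ?P = x \<otimes>\<^bsub>Gamma\<^esub> y" using hom_mult[OF h(1), of R0 R2] h by simp
  define a b where "a = (if x = R0 then R0 else if y = R0 then R2 else ?P)"
    and "b = (if x = R2 then R0 else if y = R2 then R2 else ?P)"
  have ab: "a \<in> V_involutions" "b \<in> V_involutions" "a \<noteq> b"
    using xy V_distinct by (auto simp: a_def b_def V_involutions_def)
  from hom[OF ab] obtain k where k: "k \<in> hom Gamma Gamma" "k R0 = a" "k R1 = R1" "k R2 = b" by blast
  have kP: "k ?P = a \<otimes>\<^bsub>Gamma\<^esub> b" using hom_mult[OF k(1), of R0 R2] k by simp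
  consider "x = R0" "y = R2" | "x = R0" "y = ?P" | "x = R2" "y = R0" | "x = R2" "y = ?P"
    | "x = ?P" "y = R0" | "x = ?P" "y = R2"
    using xy by (auto simp: V_involutions_def)
  note six = this
  have gens: "h a = R0 \<and> h b = R2 \<and> k x = R0 \<and> k y = R2"
    by (rule six)
      (simp_all add: a_def b_def h(2,4) k(2,4) hP kP V_mult V_distinct V_distinct[symmetric])
  have V: "{x, y, x \<otimes>\<^bsub>Gamma\<^esub> y} = V_involutions"
    by (rule six) (auto simp: V_involutions_def V_mult)
  have id: "(\<lambda>x. x) \<in> hom Gamma Gamma" by (rule homI) auto
  have hk: "h (k z) = z" if "z \<in> carrier Gamma" for z
  proof -
    have "(h \<circ> k) z = z"
      by (rule Gamma_hom_ext[OF Gamma.group_axioms Group.hom_compose[OF k(1) h(1)] id _ _ _ that])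
        (simp_all add: gens h(2-4) k(2-4))
    then show ?thesis by simp
  qed
  have kh: "k (h z) = z" if "z \<in> carrier Gamma" for z
  proof -
    have "(k \<circ> h) z = z"
      by (rule Gamma_hom_ext[OF Gamma.group_axioms Group.hom_compose[OF h(1) k(1)] id _ _ _ that])
        (simp_all add: gens h(2-4) k(2-4))
    then show ?thesis by simp
  qed
  have bij: "bij_betw h (carrier Gamma) (carrier Gamma)"
    using h(1) k(1) hk kh by (intro bij_betw_byWitness[of _ k]) (auto simp: hom_def)
  define \<sigma> where "\<sigma> = restrict h (carrier Gamma)"
  have "\<sigma> \<in> hom Gamma Gamma" using h(1) by (auto simp: hom_def \<sigma>_def)
  moreover have "\<sigma> \<in> Bij (carrier Gamma)"
    using bij by (simp add: Bij_def \<sigma>_def cong: bij_betw_cong)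
  moreover have "\<sigma> ` V_involutions = V_involutions"
    using V by (simp add: V_involutions_def \<sigma>_def h hP)
  moreover have "\<sigma> R1 = R1" "V_images \<sigma> = (x, y)"
    using h by (simp_all add: \<sigma>_def V_images_def)
  ultimately show ?thesis
    by (intro bexI[of _ \<sigma>]) (simp_all add: Sigma_group_def auto_def)
qed

lemma V_images_Sigma:
  "V_images ` carrier Sigma_group = {(x, y). x \<in> V_involutions \<and> y \<in> V_involutions \<and> x \<noteq> y}"
proof
  show "V_images ` carrier Sigma_group \<subseteq> {(x, y). x \<in> V_involutions \<and> y \<in> V_involutions \<and> x \<noteq> y}"
  proof (rule image_subsetI)
    fix \<sigma> assume s: "\<sigma> \<in> carrier Sigma_group"
    then have "\<sigma> ` V_involutions = V_involutions" by (simp add: Sigma_group_def)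
    then have "\<sigma> R0 \<in> V_involutions" "\<sigma> R2 \<in> V_involutions"
      by (auto simp: V_involutions_def)
    moreover have "inj_on \<sigma> (carrier Gamma)"
      using s by (simp add: Sigma_group_def auto_def Bij_def bij_betw_def)
    then have "\<sigma> R0 \<noteq> \<sigma> R2" using V_distinct(1) inj_on_eq_iff R_closed by metis
    ultimately show "V_images \<sigma> \<in> {(x, y). x \<in> V_involutions \<and> y \<in> V_involutions \<and> x \<noteq> y}"
      by (simp add: V_images_def)
  qed
qed (use Sigma_existence in force)

lemma card_Sigma_group: "card (carrier Sigma_group) = 6"
proof -
  have "{(x, y). x \<in> V_involutions \<and> y \<in> V_involutions \<and> x \<noteq> y}
    = (V_involutions \<times> V_involutions) - (\<lambda>x. (x, x)) ` V_involutions" by auto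
  moreover have "finite V_involutions" "card V_involutions = 3"
    using V_distinct by (auto simp: V_involutions_def)
  moreover have "card ((\<lambda>x. (x, x)) ` V_involutions) = card V_involutions"
    by (rule card_image) (auto intro: inj_onI)
  ultimately have "card (V_images ` carrier Sigma_group) = 6"
    unfolding V_images_Sigma by (simp add: card_Diff_subset card_cartesian_product image_subset_iff)
  then show ?thesis using card_image[OF inj_V_images] by simp
qed

lemma ex1_subgroup_order_3: "\<exists>!H. subgroup H Sigma_group \<and> card H = 3"
proof -
  interpret S: group Sigma_group by (rule group_Sigma_group)
  let ?P = "R0 \<otimes>\<^bsub>Gamma\<^esub> R2"
  define T where "T = {(R0, R2), (R2, ?P), (?P, R0)}"
  define K where "K = {\<sigma> \<in> carrier Sigma_group. V_images \<sigma> \<in> T}"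
  have fin: "finite (carrier Sigma_group)" by (rule card_ge_0_finite) (simp add: card_Sigma_group)
  have sP: "\<sigma> ?P = \<sigma> R0 \<otimes>\<^bsub>Gamma\<^esub> \<sigma> R2" if "\<sigma> \<in> carrier Sigma_group" for \<sigma>
    using hom_mult[OF Sigma_hom[OF that], of R0 R2] by simp
  have mult: "(\<sigma> \<otimes>\<^bsub>Sigma_group\<^esub> \<tau>) x = \<sigma> (\<tau> x)"
    if "\<sigma> \<in> carrier Sigma_group" "\<tau> \<in> carrier Sigma_group" "x \<in> carrier Gamma" for \<sigma> \<tau> x
    using that by (simp add: Sigma_mult compose_eq)
  have T: "T \<subseteq> V_images ` carrier Sigma_group"
    unfolding V_images_Sigma using V_distinct by (auto simp: T_def V_involutions_def)
  then have imK: "V_images ` K = T" by (auto simp: K_def)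
  have "card T = 3" using V_distinct by (auto simp: T_def)
  then have cardK: "card K = 3"
    using card_image[OF inj_on_subset[OF inj_V_images, of K]] imK by (auto simp: K_def)
  have oneK: "\<one>\<^bsub>Sigma_group\<^esub> \<in> K" by (simp add: K_def) (simp add: Sigma_one V_images_def T_def)
  have multK: "\<sigma> \<otimes>\<^bsub>Sigma_group\<^esub> \<tau> \<in> K" if "\<sigma> \<in> K" "\<tau> \<in> K" for \<sigma> \<tau>
  proof -
    have c: "\<sigma> \<in> carrier Sigma_group" "\<tau> \<in> carrier Sigma_group" using that by (auto simp: K_def)
    have "V_images (\<sigma> \<otimes>\<^bsub>Sigma_group\<^esub> \<tau>) = (\<sigma> (\<tau> R0), \<sigma> (\<tau> R2))"
      using c by (simp add: V_images_def mult)
    also have "\<dots> \<in> T"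
    proof -
      have t: "(\<tau> R0, \<tau> R2) \<in> T" and "(\<sigma> R0, \<sigma> R2) \<in> T"
        using that by (simp_all add: K_def V_images_def)
      then consider "\<sigma> R0 = R0" "\<sigma> R2 = R2" | "\<sigma> R0 = R2" "\<sigma> R2 = ?P" | "\<sigma> R0 = ?P" "\<sigma> R2 = R0"
        unfolding T_def by blast
      then show ?thesis
      proof cases
        case 1
        with t sP[OF c(1)] show ?thesis unfolding T_def by (elim insertE emptyE) simp_all
      next
        case 2
        with t sP[OF c(1)] show ?thesis unfolding T_def by (elim insertE emptyE) (simp_all add: V_mult)
      next
        case 3
        with t sP[OF c(1)] show ?thesis unfolding T_def by (elim insertE emptyE) (simp_all add: V_mult)
      qed
    qed
    finally show ?thesis using c by (simp add: K_def)
  qed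
  have "subgroup K Sigma_group"
  proof (rule S.subgroupI)
    show "K \<subseteq> carrier Sigma_group" "K \<noteq> {}" using oneK by (auto simp: K_def)
  next
    fix \<sigma> assume s: "\<sigma> \<in> K"
    then have c: "\<sigma> \<in> carrier Sigma_group" by (simp add: K_def)
    have pow: "\<sigma> [^]\<^bsub>Sigma_group\<^esub> (n::nat) \<in> K" for n
      by (induction n) (use oneK multK s in auto)
    have "\<sigma> [^]\<^bsub>Sigma_group\<^esub> (5::nat) \<otimes>\<^bsub>Sigma_group\<^esub> \<sigma> = \<sigma> [^]\<^bsub>Sigma_group\<^esub> (6::nat)"
      using S.nat_pow_Suc[of \<sigma> 5] by simp
    also have "\<dots> = \<one>\<^bsub>Sigma_group\<^esub>"
      using S.pow_order_eq_1[OF c] card_Sigma_group by (simp add: order_def)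
    finally have "inv\<^bsub>Sigma_group\<^esub> \<sigma> = \<sigma> [^]\<^bsub>Sigma_group\<^esub> (5::nat)"
      using c by (intro S.inv_equality) auto
    then show "inv\<^bsub>Sigma_group\<^esub> \<sigma> \<in> K" using pow by simp
  qed (use multK in auto)
  moreover have "H = K" if H: "subgroup H Sigma_group" "card H = 3" for H
  proof -
    have "H \<subseteq> K"
    proof
      fix \<sigma> assume s: "\<sigma> \<in> H"
      then have c: "\<sigma> \<in> carrier Sigma_group" by (rule subgroup.mem_carrier[OF H(1)])
      interpret H: group "Sigma_group\<lparr>carrier := H\<rparr>" by (rule S.subgroup_imp_group[OF H(1)])
      have "\<sigma> \<otimes>\<^bsub>Sigma_group\<^esub> \<sigma> \<otimes>\<^bsub>Sigma_group\<^esub> \<sigma> = \<one>\<^bsub>Sigma_group\<^esub>"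
        using H.pow_order_eq_1[of \<sigma>] s c H(2) by (simp add: order_def numeral_3_eq_3)
      then have "(\<sigma> \<otimes>\<^bsub>Sigma_group\<^esub> \<sigma> \<otimes>\<^bsub>Sigma_group\<^esub> \<sigma>) x = x" if "x \<in> carrier Gamma" for x
        using that by (simp add: Sigma_one)
      then have cube: "\<sigma> (\<sigma> (\<sigma> x)) = x" if "x \<in> carrier Gamma" for x
        using that c Sigma_hom[OF c] by (simp add: mult hom_in_carrier)
      have "V_images \<sigma> \<in> {(x, y). x \<in> V_involutions \<and> y \<in> V_involutions \<and> x \<noteq> y}"
        using imageI[OF c, of V_images] unfolding V_images_Sigma .
      then consider "V_images \<sigma> \<in> T"
        | "\<sigma> R0 = R0" "\<sigma> R2 = ?P" | "\<sigma> R0 = R2" "\<sigma> R2 = R0" | "\<sigma> R0 = ?P" "\<sigma> R2 = R2"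
        by (auto simp: V_images_def T_def V_involutions_def)
      then have "V_images \<sigma> \<in> T"
        using cube[of R0] cube[of R2] sP[OF c] V_distinct
        by cases (simp_all add: V_images_def T_def V_mult)
      then show "\<sigma> \<in> K" using c by (simp add: K_def)
    qed
    moreover have "finite K" using fin by (simp add: K_def)
    ultimately show ?thesis using H(2) cardK card_subset_eq by metis
  qed
  ultimately show ?thesis using cardK by blast
qed

end

theory Submission
  imports Defs
begin

text \<open>The map subgroup \<open>N\<close> behaves like a prime ideal: in the almost simple group \<open>\<Gamma>/N\<close> every
  non-trivial normal subgroup contains \<open>S\<close>, and \<open>S\<close> is not abelian, so two normal subgroups of
  \<open>\<Gamma>\<close>, which commute modulo their intersection, cannot intersect inside \<open>N\<close> unless one of
  them lies in \<open>N\<close>. The orbit of \<open>K = N\<^bsub>\<Sigma>\<^sup>+\<^esub>\<close> consists of \<open>K\<close> and of the intersection \<open>K'\<close> of the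
  \<open>\<tau>(N)\<close> with \<open>\<tau> \<in> \<Sigma> - \<Sigma>\<^sup>+\<close>. If \<open>K = K'\<close>, then \<open>K' \<le> N\<close>, hence \<open>\<tau>(N) \<le> N\<close> for some
  \<open>\<tau> \<notin> \<Sigma>\<^sup>+\<close>; as \<open>\<tau>\<close> has finite order, \<open>\<tau>(N) = N\<close>, contrary to class I.\<close>

section \<open>Normal subgroups and almost simple quotients\<close>

text \<open>The witness is the commutator of \<open>a\<close> and \<open>b\<close>: it is
  \<open>a\<close> times a conjugate of \<open>inv a\<close>, hence in \<open>A\<close>, and a
  conjugate of \<open>b\<close> times \<open>inv b\<close>, hence in \<open>B\<close>.\<close>

lemma (in group) normal_commute_mod_Int:
  assumes A: "A \<lhd> G" and B: "B \<lhd> G" and a: "a \<in> A" and b: "b \<in> B"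
  shows "\<exists>c \<in> A \<inter> B. a \<otimes> b = c \<otimes> (b \<otimes> a)"
proof -
  interpret A: normal A G by (rule A)
  interpret B: normal B G by (rule B)
  have G: "a \<in> carrier G" "b \<in> carrier G" using a b by auto
  have "a \<otimes> (b \<otimes> inv a \<otimes> inv b) \<in> A"
    using A.m_closed[OF a A.inv_op_closed2[OF G(2) A.m_inv_closed[OF a]]] .
  moreover have "a \<otimes> b \<otimes> inv a \<otimes> inv b \<in> B"
    using B.m_closed[OF B.inv_op_closed2[OF G(1) b] B.m_inv_closed[OF b]] .
  moreover have "a \<otimes> b \<otimes> inv a \<otimes> inv b = a \<otimes> (b \<otimes> inv a \<otimes> inv b)"
    using G by (simp add: m_assoc)
  moreover have "a \<otimes> b = a \<otimes> b \<otimes> inv a \<otimes> inv b \<otimes> (b \<otimes> a)"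
    using G by (simp add: m_assoc) (simp add: m_assoc[symmetric])
  ultimately show ?thesis by auto
qed

text \<open>By simplicity \<open>L \<inter> S\<close> is \<open>S\<close> or trivial. If it were
  trivial, \<open>L\<close> and \<open>S\<close> would commute elementwise, which puts
  \<open>L\<close> into the trivial centralizer of \<open>S\<close>.\<close>

lemma (in group) simple_normal_subset_normal:
  assumes S: "S \<lhd> G" "is_simple (G\<lparr>carrier := S\<rparr>)" "centralizer G S = {\<one>}"
    and L: "L \<lhd> G" "L \<noteq> {\<one>}"
  shows "S \<subseteq> L"
proof -
  have sub: "subgroup S G" "subgroup L G" using S L by (auto intro: normal_imp_subgroup)
  have "L \<inter> S \<lhd> G\<lparr>carrier := S\<rparr>"
    by (rule normal_Int_subgroup[OF sub(1) L(1)])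
  then have "L \<inter> S = S \<or> L \<inter> S = {\<one>}"
    using S(2) by (auto simp: is_simple_def)
  moreover have False if triv: "L \<inter> S = {\<one>}"
  proof -
    have "L \<subseteq> centralizer G S"
    proof
      fix x assume x: "x \<in> L"
      have "x \<otimes> s = s \<otimes> x" if "s \<in> S" for s
        using normal_commute_mod_Int[OF L(1) S(1) x that] x that triv
          subgroup.mem_carrier[OF sub(1)] subgroup.mem_carrier[OF sub(2)] by auto
      then show "x \<in> centralizer G S"
        using x subgroup.mem_carrier[OF sub(2)] by (auto simp: centralizer_def)
    qed
    then show False using L(2) S(3) subgroup.one_closed[OF sub(2)] by auto
  qed
  ultimately show ?thesis by blast
qed

lemma (in group) almost_simple_Mod_Int_subset:
  assumes P: "P \<lhd> G" and as: "almost_simple (G Mod P)"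
    and A: "A \<lhd> G" and B: "B \<lhd> G" and AB: "A \<inter> B \<subseteq> P"
  shows "A \<subseteq> P \<or> B \<subseteq> P"
proof (rule ccontr)
  assume neg: "\<not> (A \<subseteq> P \<or> B \<subseteq> P)"
  interpret P: normal P G by (rule P)
  interpret Q: group "G Mod P" by (rule P.factorgroup_is_group)
  define h where "h x = P #> x" for x
  have hom: "h \<in> hom G (G Mod P)"
    using P.r_coset_hom_Mod by (simp add: h_def[abs_def])
  interpret h: group_hom G "G Mod P" h
    by unfold_locales (rule hom)
  have surj: "h ` carrier G = carrier (G Mod P)"
    by (simp add: carrier_FactGroup h_def)
  obtain S where S: "S \<lhd> G Mod P" "is_simple ((G Mod P)\<lparr>carrier := S\<rparr>)"
      "\<not> comm_group ((G Mod P)\<lparr>carrier := S\<rparr>)" "centralizer (G Mod P) S = {\<one>\<^bsub>G Mod P\<^esub>}"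
    using as unfolding almost_simple_def by blast
  have image: "S \<subseteq> h ` L" if L: "L \<lhd> G" "\<not> L \<subseteq> P" for L
  proof (rule Q.simple_normal_subset_normal[OF S(1,2,4)])
    show "h ` L \<lhd> G Mod P"
      by (rule normal.surj_hom_normal_subgroup[OF L(1) h.group_hom_axioms surj])
    obtain x where x: "x \<in> L" "x \<notin> P" using L(2) by blast
    moreover have "x \<in> carrier G"
      using x L(1) normal_imp_subgroup subgroup.mem_carrier by metis
    ultimately have "h x \<noteq> P"
      using rcos_self[of x P] P.subgroup_axioms x by (auto simp: h_def)
    then show "h ` L \<noteq> {\<one>\<^bsub>G Mod P\<^esub>}" using x by auto
  qed
  have "subgroup S (G Mod P)" using S(1) by (rule normal_imp_subgroup)
  then interpret S: group "(G Mod P)\<lparr>carrier := S\<rparr>" by (rule Q.subgroup_imp_group)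
  have "s \<otimes>\<^bsub>G Mod P\<^esub> t = t \<otimes>\<^bsub>G Mod P\<^esub> s" if st: "s \<in> S" "t \<in> S" for s t
  proof -
    \<comment> \<open>\<open>S\<close> lies in the images of both \<open>A\<close> and
      \<open>B\<close>, so the two elements can be lifted to different subgroups; the commutator of
      the lifts lies in \<open>A \<inter> B\<close> and vanishes modulo \<open>P\<close>.\<close>
    obtain a b where a: "a \<in> A" "s = h a" and b: "b \<in> B" "t = h b"
      using image[OF A] image[OF B] neg st by blast
    then obtain c where c: "c \<in> A \<inter> B" "a \<otimes> b = c \<otimes> (b \<otimes> a)"
      using normal_commute_mod_Int[OF A B] by blast
    have G: "a \<in> carrier G" "b \<in> carrier G" "c \<in> carrier G"
      using a b c A B normal_imp_subgroup subgroup.mem_carrier by (metis Int_iff)+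
    have "h c = \<one>\<^bsub>G Mod P\<^esub>"
      using c AB P.rcos_const by (auto simp: h_def)
    moreover have "h (a \<otimes> b) = h c \<otimes>\<^bsub>G Mod P\<^esub> h (b \<otimes> a)"
      using c G by (simp del: mult_FactGroup)
    ultimately show ?thesis
      using a b G by (simp del: mult_FactGroup one_FactGroup)
  qed
  then have "comm_group ((G Mod P)\<lparr>carrier := S\<rparr>)"
    by (intro S.group_comm_groupI) simp
  with S(3) show False by blast
qed

lemma (in group) normal_INT:
  assumes "I \<noteq> {}" and "\<And>i. i \<in> I \<Longrightarrow> A i \<lhd> G"
  shows "(\<Inter>i\<in>I. A i) \<lhd> G"
proof (rule normal_invI)
  show "subgroup (\<Inter>i\<in>I. A i) G"
    using assms by (intro subgroups_Inter) (auto intro: normal_imp_subgroup)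
qed (use assms in \<open>auto intro: normal.inv_op_closed2\<close>)

text \<open>One member is split off at a time, the remaining intersection being normal again. The
  induction starts at singletons, since an empty intersection is \<open>UNIV\<close>, in general not
  a subgroup.\<close>

lemma (in group) almost_simple_Mod_INT_subset:
  assumes P: "P \<lhd> G" and as: "almost_simple (G Mod P)"
    and "finite I" "I \<noteq> {}" and "\<And>i. i \<in> I \<Longrightarrow> A i \<lhd> G" and "(\<Inter>i\<in>I. A i) \<subseteq> P"
  shows "\<exists>i\<in>I. A i \<subseteq> P"
  using assms(3-)
proof (induction rule: finite_ne_induct)
  case (insert i I)
  have "(\<Inter>j\<in>I. A j) \<lhd> G" using insert.hyps insert.prems by (intro normal_INT) auto
  then have "A i \<subseteq> P \<or> (\<Inter>j\<in>I. A j) \<subseteq> P"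
    using insert.prems by (intro almost_simple_Mod_Int_subset[OF P as]) auto
  then show ?case using insert by auto
qed simp

section \<open>The action of \<Sigma> on normal subgroups\<close>

interpretation Sigma: group Sigma_group
  by (rule group_Sigma_group)

lemma finite_Sigma: "finite (carrier Sigma_group)"
  by (rule card_ge_0_finite) (simp add: card_Sigma_group)

lemma Sigma_bij: "\<sigma> \<in> carrier Sigma_group \<Longrightarrow> bij_betw \<sigma> (carrier Gamma) (carrier Gamma)"
  by (simp add: Sigma_group_def auto_def Bij_def)

text \<open>The product in \<open>Sigma_group\<close> is composition restricted to
  \<open>carrier Gamma\<close>, so it acts as plain composition only on subsets of that
  carrier.\<close>

lemma Sigma_image_mult:
  assumes "\<sigma> \<in> carrier Sigma_group" "\<tau> \<in> carrier Sigma_group" "M \<subseteq> carrier Gamma"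
  shows "(\<sigma> \<otimes>\<^bsub>Sigma_group\<^esub> \<tau>) ` M = \<sigma> ` \<tau> ` M"
  unfolding image_image using assms(3)
  by (intro image_cong HOL.refl) (auto simp: Sigma_mult[OF assms(1,2)] compose_eq)

lemma Sigma_image_one: "M \<subseteq> carrier Gamma \<Longrightarrow> \<one>\<^bsub>Sigma_group\<^esub> ` M = M"
  by (simp add: Sigma_one subset_iff cong: image_cong_simp)

lemma Sigma_image_normal:
  assumes "\<sigma> \<in> carrier Sigma_group" "M \<lhd> Gamma"
  shows "\<sigma> ` M \<lhd> Gamma"
proof (rule iso_normal_subgroup[OF _ Gamma.group_axioms Gamma.group_axioms assms(2)])
  show "\<sigma> \<in> iso Gamma Gamma"
    using Sigma_hom[OF assms(1)] Sigma_bij[OF assms(1)] by (simp add: iso_def)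
qed

lemma Sigma_image_INT:
  assumes s: "\<sigma> \<in> carrier Sigma_group" and I: "I \<subseteq> carrier Sigma_group" "I \<noteq> {}"
    and M: "M \<subseteq> carrier Gamma"
  shows "\<sigma> ` (\<Inter>\<tau>\<in>I. \<tau> ` M) = (\<Inter>\<tau>\<in>(\<otimes>\<^bsub>Sigma_group\<^esub>) \<sigma> ` I. \<tau> ` M)"
proof -
  have "\<tau> ` M \<subseteq> carrier Gamma" if "\<tau> \<in> I" for \<tau>
    using Sigma_bij[of \<tau>] I M that by (auto simp: bij_betw_def)
  moreover obtain \<rho> where "\<rho> \<in> I" using I(2) by blast
  ultimately have "\<sigma> ` (\<Inter>\<tau>\<in>I. \<tau> ` M) = (\<Inter>\<tau>\<in>I. \<sigma> ` \<tau> ` M)"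
    by (intro image_INT[OF bij_betw_imp_inj_on[OF Sigma_bij[OF s]]]) auto
  also have "\<dots> = (\<Inter>\<tau>\<in>I. (\<sigma> \<otimes>\<^bsub>Sigma_group\<^esub> \<tau>) ` M)"
    by (intro INF_cong HOL.refl Sigma_image_mult[symmetric] s M subsetD[OF I(1)])
  finally show ?thesis by (simp only: image_image)
qed

lemma Sigma_image_subset_imp_eq:
  assumes s: "\<sigma> \<in> carrier Sigma_group" and M: "M \<subseteq> carrier Gamma" and sub: "\<sigma> ` M \<subseteq> M"
  shows "\<sigma> ` M = M"
proof -
  have pow: "(\<sigma> [^]\<^bsub>Sigma_group\<^esub> (n::nat)) ` M \<subseteq> M" for n
  proof (induction n)
    case (Suc n)
    have "(\<sigma> [^]\<^bsub>Sigma_group\<^esub> Suc n) ` M = (\<sigma> [^]\<^bsub>Sigma_group\<^esub> n) ` \<sigma> ` M"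
      unfolding Sigma.nat_pow_Suc by (rule Sigma_image_mult[OF Sigma.nat_pow_closed[OF s] s M])
    also have "\<dots> \<subseteq> (\<sigma> [^]\<^bsub>Sigma_group\<^esub> n) ` M" by (rule image_mono[OF sub])
    finally show ?case using Suc by (rule subset_trans)
  qed (simp add: Sigma_image_one M)
  \<comment> \<open>As \<Sigma> has order 6, the fifth power inverts \<open>\<sigma>\<close>.
    Applying \<open>\<sigma>\<close> to the inclusion for that power yields the reverse inclusion;
    no finiteness of \<open>M\<close> enters.\<close>
  have "\<sigma> \<otimes>\<^bsub>Sigma_group\<^esub> \<sigma> [^]\<^bsub>Sigma_group\<^esub> (5::nat) = \<sigma> [^]\<^bsub>Sigma_group\<^esub> (Suc 5)"
    by (rule Sigma.nat_pow_Suc2[OF s, symmetric])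
  also have "\<dots> = \<one>\<^bsub>Sigma_group\<^esub>"
    using Sigma.pow_order_eq_1[OF s] card_Sigma_group by (simp add: order_def)
  finally have "\<sigma> ` (\<sigma> [^]\<^bsub>Sigma_group\<^esub> (5::nat)) ` M = M"
    using Sigma_image_mult[OF s Sigma.nat_pow_closed[OF s] M, of 5] Sigma_image_one[OF M] by simp
  with image_mono[OF pow[of 5], of \<sigma>] have "M \<subseteq> \<sigma> ` M" by (simp only:)
  with sub show ?thesis by (rule subset_antisym)
qed

section \<open>Cosets of the subgroup of order 3 and the orbit of the core\<close>

lemma Sigma_plus: "subgroup Sigma_plus Sigma_group" "card Sigma_plus = 3"
  using theI'[OF ex1_subgroup_order_3] by (simp_all add: Sigma_plus_def)

lemma Sigma_plus_psubset: "Sigma_plus \<subset> carrier Sigma_group"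
  using subgroup.subset[OF Sigma_plus(1)] Sigma_plus(2) card_Sigma_group by (intro psubsetI) auto

lemma Sigma_plus_coset:
  assumes s: "\<sigma> \<in> carrier Sigma_group"
  shows "(\<otimes>\<^bsub>Sigma_group\<^esub>) \<sigma> ` Sigma_plus
    = (if \<sigma> \<in> Sigma_plus then Sigma_plus else carrier Sigma_group - Sigma_plus)"
proof -
  interpret H: subgroup Sigma_plus Sigma_group by (rule Sigma_plus(1))
  have fin: "finite Sigma_plus" using H.subset finite_Sigma by (rule finite_subset)
  have sub: "(\<otimes>\<^bsub>Sigma_group\<^esub>) \<sigma> ` Sigma_plus
      \<subseteq> (if \<sigma> \<in> Sigma_plus then Sigma_plus else carrier Sigma_group - Sigma_plus)"
  proof (cases "\<sigma> \<in> Sigma_plus")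
    case False
    have "\<sigma> \<otimes>\<^bsub>Sigma_group\<^esub> \<tau> \<notin> Sigma_plus" if t: "\<tau> \<in> Sigma_plus" for \<tau>
    proof
      assume "\<sigma> \<otimes>\<^bsub>Sigma_group\<^esub> \<tau> \<in> Sigma_plus"
      from H.m_closed[OF this H.m_inv_closed[OF t]] have "\<sigma> \<in> Sigma_plus"
        using s t by (simp add: Sigma.m_assoc)
      with False show False ..
    qed
    then show ?thesis using s False by auto
  qed auto
  have "inj_on ((\<otimes>\<^bsub>Sigma_group\<^esub>) \<sigma>) Sigma_plus"
    using s by (auto intro!: inj_onI)
  then have "card ((\<otimes>\<^bsub>Sigma_group\<^esub>) \<sigma> ` Sigma_plus) = 3"
    using Sigma_plus(2) by (simp add: card_image)
  \<comment> \<open>The index is 2, so the coset and the set containing it both have three elements,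
    and inclusion becomes equality.\<close>
  moreover have "card (carrier Sigma_group - Sigma_plus) = 3"
    using card_Diff_subset[OF fin H.subset] Sigma_plus(2) card_Sigma_group by simp
  ultimately show ?thesis
    using sub Sigma_plus(2) fin finite_Sigma by (intro card_subset_eq) auto
qed

text \<open>Applying \<open>\<sigma>\<close> to the core translates the index set
  \<open>Sigma_plus\<close> on the left, giving either itself or its complement. The two listed
  members may still coincide here.\<close>

lemma Sigma_orbit_core:
  assumes M: "M \<subseteq> carrier Gamma"
  shows "Sigma_orbit (Sigma_plus_core M)
    = {Sigma_plus_core M, \<Inter>\<tau> \<in> carrier Sigma_group - Sigma_plus. \<tau> ` M}"
proof -
  interpret H: subgroup Sigma_plus Sigma_group by (rule Sigma_plus(1))
  let ?K = "Sigma_plus_core M"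
  let ?K' = "\<Inter>\<tau> \<in> carrier Sigma_group - Sigma_plus. \<tau> ` M"
  have ne: "Sigma_plus \<noteq> {}" using H.one_closed by blast
  have "\<sigma> ` ?K = (if \<sigma> \<in> Sigma_plus then ?K else ?K')"
    if s: "\<sigma> \<in> carrier Sigma_group" for \<sigma>
    unfolding Sigma_plus_core_def Sigma_image_INT[OF s H.subset ne M] Sigma_plus_coset[OF s]
    by simp
  then have orbit: "Sigma_orbit ?K = (\<lambda>\<sigma>. if \<sigma> \<in> Sigma_plus then ?K else ?K') ` carrier Sigma_group"
    unfolding Sigma_orbit_def by (rule image_cong[OF HOL.refl])
  have "(\<lambda>\<sigma>. if \<sigma> \<in> Sigma_plus then A else B) ` carrier Sigma_group = {A, B}" for A B :: "'a"
    using ne Sigma_plus_psubset by (auto simp: image_iff)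
  then show ?thesis unfolding orbit .
qed

section \<open>The two members of the orbit are distinct\<close>

theorem theorem5p2:
  fixes N :: "generator word set set"
  assumes "class_I N" and "almost_simple (Aut_map N)"
  shows "class_III (Sigma_plus_core N)"
proof -
  let ?K = "Sigma_plus_core N"
  let ?K' = "\<Inter>\<tau> \<in> carrier Sigma_group - Sigma_plus. \<tau> ` N"
  interpret H: subgroup Sigma_plus Sigma_group by (rule Sigma_plus(1))
  have map: "regular_map N" and card: "card (Sigma_orbit N) = 6"
    using assms(1) by (auto simp: class_I_def)
  have normal: "N \<lhd> Gamma" using map by (simp add: regular_map_def)
  then have N: "N \<subseteq> carrier Gamma"
    by (intro subgroup.subset normal_imp_subgroup)
  have K_sub: "?K \<subseteq> N"
    using H.one_closed Sigma_image_one[OF N] by (auto simp: Sigma_plus_core_def)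
  have "?K \<lhd> Gamma"
    unfolding Sigma_plus_core_def
  proof (rule Gamma.normal_INT)
    show "Sigma_plus \<noteq> {}" using H.one_closed by blast
  qed (rule Sigma_image_normal[OF H.mem_carrier normal])
  \<comment> \<open>A forbidden conjugate in the core would also lie in \<open>N\<close>.\<close>
  then have "regular_map ?K"
    using map K_sub by (auto simp: regular_map_def)
  moreover have "?K \<noteq> ?K'"
  proof
    assume "?K = ?K'"
    then have "?K' \<subseteq> N" using K_sub by simp
    moreover have "carrier Sigma_group - Sigma_plus \<noteq> {}"
      using Sigma_plus_psubset by blast
    ultimately obtain \<tau> where t: "\<tau> \<in> carrier Sigma_group" "\<tau> \<notin> Sigma_plus" "\<tau> ` N \<subseteq> N"
      using Gamma.almost_simple_Mod_INT_subset[OF normal assms(2)[unfolded Aut_map_def],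
          of "carrier Sigma_group - Sigma_plus" "\<lambda>\<tau>. \<tau> ` N"]
        finite_Sigma Sigma_image_normal[OF _ normal] by auto
    \<comment> \<open>The orbit of \<open>N\<close> has as many elements as \<Sigma>, so the
      stabilizer of \<open>N\<close> is trivial.\<close>
    have "inj_on (\<lambda>\<sigma>. \<sigma> ` N) (carrier Sigma_group)"
      using card card_Sigma_group finite_Sigma
      by (intro eq_card_imp_inj_on) (auto simp: Sigma_orbit_def)
    moreover have "\<tau> ` N = \<one>\<^bsub>Sigma_group\<^esub> ` N"
      using Sigma_image_subset_imp_eq[OF t(1) N t(3)] Sigma_image_one[OF N] by simp
    ultimately have "\<tau> = \<one>\<^bsub>Sigma_group\<^esub>"
      using t(1) by (auto dest: inj_onD)
    with t(2) H.one_closed show False by simp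
  qed
  ultimately show ?thesis
    by (simp add: class_III_def Sigma_orbit_core[OF N])
qed

end
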